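(* Let $X\sim\mathrm{Unif}[0,1]$, let $\beta_1^\star\neq\beta_2^\star$ be vectors in $\mathbb{R}^J$, let $\alpha^\star:[0,1]\to[0,1]$ be nondecreasing, let $w^\star(x)=\alpha^\star(x)\beta_1^\star+(1-\alpha^\star(x))\beta_2^\star$, and put $\Delta\beta^\star:=\beta_1^\star-\beta_2^\star$. Let $C_{1/2}(x):=\mathbf{1}\{\alpha^\star(x)\ge1/2\}$ and let $\mathcal{W}_{C_{1/2}}$ be the set of functions $w:[0,1]\to\mathbb{R}^J$ of the form $w(x)=\gamma_{C_{1/2}(x)}$ for some $\gamma_0,\gamma_1\in\mathbb{R}^J$. Then $$\inf_{w\in\mathcal{W}_{C_{1/2}}}\mathbb{E}\left[\|w^\star(X)-w(X)\|_2^2\right]\le\|\Delta\beta^\star\|_2^2\,\mathbb{E}\left[\min\left\{(\alpha^\star(X))^2,(1-\alpha^\star(X))^2\right\}\right].$$ Consequently, for every $\varepsilon\in(0,1/2)$, $$\inf_{w\in\mathcal{W}_{C_{1/2}}}\mathbb{E}\left[\|w^\star(X)-w(X)\|_2^2\right]\le\|\Delta\beta^\star\|_2^2\left(\varepsilon^2+\frac14\,\mathbb{P}\left(\alpha^\star(X)\in[\varepsilon,1-\varepsilon]\right)\right).$$ *)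

theory Defs
  imports "HOL-Probability.Probability"
begin

text \<open>
  Functions on $[0,1]$ are total functions on the reals of which only the values on
  \<^term>\<open>{0..1::real}\<close> are constrained. Hence, for a random variable \<open>X\<close> with the uniform
  law, \<open>X\<close> is required to take its values in \<^term>\<open>{0..1::real}\<close> surely: on a null set where
  \<open>X\<close> leaves the interval, \<open>\<alpha> \<circ> X\<close> could fail to be measurable, and the Bochner integral of a
  non-measurable function is $0$ by convention.
\<close>

definition uniform_unit_rv :: "'a measure \<Rightarrow> ('a \<Rightarrow> real) \<Rightarrow> bool" where
  "uniform_unit_rv M X \<longleftrightarrow>
     X \<in> M \<rightarrow>\<^sub>M lborel \<and> X \<in> space M \<rightarrow> {0..1} \<and>
     distr M lborel X = uniform_measure lborel {0..1}"

definition mix_weight ::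
  "(real \<Rightarrow> real) \<Rightarrow> real ^ 'j \<Rightarrow> real ^ 'j \<Rightarrow> real \<Rightarrow> real ^ 'j" where
  "mix_weight \<alpha> \<beta>\<^sub>1 \<beta>\<^sub>2 x = \<alpha> x *\<^sub>R \<beta>\<^sub>1 + (1 - \<alpha> x) *\<^sub>R \<beta>\<^sub>2"

definition half_partition :: "(real \<Rightarrow> real) \<Rightarrow> real \<Rightarrow> nat" where
  "half_partition \<alpha> x = of_bool (\<alpha> x \<ge> 1 / 2)"

text \<open>For a $\{0,1\}$-valued \<open>C\<close>, only \<open>\<gamma> 0\<close> and \<open>\<gamma> 1\<close> matter.\<close>

definition cellwise_const :: "(real \<Rightarrow> nat) \<Rightarrow> (real \<Rightarrow> real ^ 'j) set" where
  "cellwise_const C = {w. \<exists>\<gamma> :: nat \<Rightarrow> real ^ 'j. \<forall>x\<in>{0..1}. w x = \<gamma> (C x)}"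

end

theory Submission
  imports Defs
begin

text \<open>The infimum is bounded by testing a single competitor: \<open>\<beta>\<^sub>1\<close> on
  the cell where \<alpha> is at least 1/2 and \<open>\<beta>\<^sub>2\<close> on the other. Its
  squared error at each point is exactly the integrand on the right, scaled by the squared distance
  of the two vectors (\<open>norm_mix_weight_diff\<close>), so integrating gives the first bound.
  The second follows from the first by integrating the pointwise estimate
  \<open>min_sq_le_indicator\<close>. That integration needs \<alpha> composed with X to be
  measurable, which monotonicity supplies (\<open>borel_measurable_mono_on_Icc\<close>).\<close>

text \<open>Clamping the argument to the interval extends f to a monotone function on the whole
  line, hence a Borel one, and the extension agrees with f on the interval. If b < a, the clamped
  function is constant.\<close>

lemma borel_measurable_mono_on_Icc:
  fixes f :: "real \<Rightarrow> real"
  assumes "mono_on {a..b} f"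
  shows "f \<in> borel_measurable (restrict_space borel {a..b})"
proof -
  have "mono (\<lambda>x. f (max a (min b x)))"
    by (cases "a \<le> b") (auto intro!: monoI mono_onD[OF assms] simp: max_absorb1)
  then have "(\<lambda>x. f (max a (min b x))) \<in> borel_measurable borel"
    by (rule borel_measurable_mono)
  then have "(\<lambda>x. f (max a (min b x))) \<in> borel_measurable (restrict_space borel {a..b})"
    by (rule measurable_restrict_space1)
  then show ?thesis
    by (rule measurable_cong[THEN iffD1, rotated]) (auto simp: space_restrict_space max_def min_def)
qed

text \<open>The mixture differs from \<open>\<beta>\<^sub>1\<close> by \<alpha> - 1 times
  \<open>\<beta>\<^sub>1 - \<beta>\<^sub>2\<close>, and from \<open>\<beta>\<^sub>2\<close> by
  \<alpha> times it. The two squared factors cross at 1/2, so thresholding there always picks the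
  smaller one.\<close>

lemma norm_mix_weight_diff:
  "(norm (mix_weight \<alpha> \<beta>\<^sub>1 \<beta>\<^sub>2 x - (if \<alpha> x \<ge> 1 / 2 then \<beta>\<^sub>1 else \<beta>\<^sub>2)))\<^sup>2
    = (norm (\<beta>\<^sub>1 - \<beta>\<^sub>2))\<^sup>2 * min ((\<alpha> x)\<^sup>2) ((1 - \<alpha> x)\<^sup>2)"
proof (cases "\<alpha> x \<ge> 1 / 2")
  case True
  then have "mix_weight \<alpha> \<beta>\<^sub>1 \<beta>\<^sub>2 x - \<beta>\<^sub>1 = (\<alpha> x - 1) *\<^sub>R (\<beta>\<^sub>1 - \<beta>\<^sub>2)"
    by (simp add: mix_weight_def algebra_simps)
  moreover have "(1 - \<alpha> x)\<^sup>2 \<le> (\<alpha> x)\<^sup>2"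
    using True by (simp add: power2_eq_square algebra_simps)
  ultimately show ?thesis
    using True by (simp add: power_mult_distrib power2_commute min_absorb2)
next
  case False
  then have "mix_weight \<alpha> \<beta>\<^sub>1 \<beta>\<^sub>2 x - \<beta>\<^sub>2 = \<alpha> x *\<^sub>R (\<beta>\<^sub>1 - \<beta>\<^sub>2)"
    by (simp add: mix_weight_def algebra_simps)
  moreover have "(\<alpha> x)\<^sup>2 \<le> (1 - \<alpha> x)\<^sup>2"
    using False by (simp add: power2_eq_square algebra_simps)
  ultimately show ?thesis
    using False by (simp add: power_mult_distrib min_absorb1)
qed

text \<open>One of a and 1 - a is at most 1/2, which bounds the minimum by 1/4. Outside the band one
  of them is even below \<epsilon>.\<close>

lemma min_sq_le_indicator:
  fixes a \<epsilon> :: real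
  assumes "0 \<le> a" "a \<le> 1"
  shows "min (a\<^sup>2) ((1 - a)\<^sup>2) \<le> \<epsilon>\<^sup>2 + 1 / 4 * indicator {\<epsilon>..1 - \<epsilon>} a"
proof -
  have quarter: "min (a\<^sup>2) ((1 - a)\<^sup>2) \<le> 1 / 4"
    using power_mono[of a "1 / 2" 2] power_mono[of "1 - a" "1 / 2" 2] assms
    by (cases "a \<le> 1 / 2") (auto simp: power2_eq_square min_le_iff_disj)
  consider "a < \<epsilon>" | "1 - a < \<epsilon>" | "a \<in> {\<epsilon>..1 - \<epsilon>}"
    by fastforce
  then show ?thesis
  proof cases
    case 1
    then show ?thesis
      using power_mono[of a \<epsilon> 2] assms by (auto simp: min_le_iff_disj indicator_def)
  next
    case 2
    then show ?thesis
      using power_mono[of "1 - a" \<epsilon> 2] assms by (auto simp: min_le_iff_disj indicator_def)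
  next
    case 3
    then show ?thesis
      using quarter by (simp add: add_increasing)
  qed
qed

theorem proposition4:
  fixes M :: "'a measure" and X :: "'a \<Rightarrow> real"
    and \<beta>\<^sub>1 \<beta>\<^sub>2 :: "real ^ 'j" and \<alpha> :: "real \<Rightarrow> real"
  assumes "prob_space M"
    and "uniform_unit_rv M X"
    and "\<beta>\<^sub>1 \<noteq> \<beta>\<^sub>2"
    and "\<alpha> \<in> {0..1} \<rightarrow> {0..1}"
    and "mono_on {0..1} \<alpha>"
  shows "(INF w \<in> cellwise_const (half_partition \<alpha>).
            prob_space.expectation M (\<lambda>\<omega>. (norm (mix_weight \<alpha> \<beta>\<^sub>1 \<beta>\<^sub>2 (X \<omega>) - w (X \<omega>)))\<^sup>2))
           \<le> (norm (\<beta>\<^sub>1 - \<beta>\<^sub>2))\<^sup>2 *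
             prob_space.expectation M (\<lambda>\<omega>. min ((\<alpha> (X \<omega>))\<^sup>2) ((1 - \<alpha> (X \<omega>))\<^sup>2)) \<and>
         (\<forall>\<epsilon> \<in> {0<..<1/2}.
            (INF w \<in> cellwise_const (half_partition \<alpha>).
               prob_space.expectation M (\<lambda>\<omega>. (norm (mix_weight \<alpha> \<beta>\<^sub>1 \<beta>\<^sub>2 (X \<omega>) - w (X \<omega>)))\<^sup>2))
              \<le> (norm (\<beta>\<^sub>1 - \<beta>\<^sub>2))\<^sup>2 *
                (\<epsilon>\<^sup>2 + 1 / 4 * \<P>(\<omega> in M. \<alpha> (X \<omega>) \<in> {\<epsilon>..1 - \<epsilon>})))"
proof -
  interpret prob_space M by fact
  let ?err = "\<lambda>w. expectation (\<lambda>\<omega>. (norm (mix_weight \<alpha> \<beta>\<^sub>1 \<beta>\<^sub>2 (X \<omega>) - w (X \<omega>)))\<^sup>2)"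
  let ?m = "\<lambda>\<omega>. min ((\<alpha> (X \<omega>))\<^sup>2) ((1 - \<alpha> (X \<omega>))\<^sup>2)"
  let ?w = "\<lambda>x. if \<alpha> x \<ge> 1 / 2 then \<beta>\<^sub>1 else \<beta>\<^sub>2"
  let ?inf = "INF w \<in> cellwise_const (half_partition \<alpha>). ?err w"
  have \<alpha>01: "0 \<le> \<alpha> (X \<omega>)" "\<alpha> (X \<omega>) \<le> 1" if "\<omega> \<in> space M" for \<omega>
    using assms(2,4) that by (fastforce simp: uniform_unit_rv_def)+
  have "?w \<in> cellwise_const (half_partition \<alpha>)"
    unfolding cellwise_const_def half_partition_def
    by (intro CollectI exI[of _ "\<lambda>n. if n = 1 then \<beta>\<^sub>1 else \<beta>\<^sub>2"]) auto
  then have "?inf \<le> ?err ?w"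
    \<comment> \<open>A real infimum lies below its members only if the set is bounded below;
      squared errors are bounded by 0.\<close>
    by (intro cINF_lower bdd_belowI[of _ 0]) auto
  then have first: "?inf \<le> (norm (\<beta>\<^sub>1 - \<beta>\<^sub>2))\<^sup>2 * expectation ?m"
    \<comment> \<open>The rule that pulls out the constant has no integrability premise, so this
      bound can precede the measurability argument.\<close>
    by (simp only: norm_mix_weight_diff Bochner_Integration.integral_mult_right_zero)
  \<comment> \<open>\<alpha> is controlled only on the unit interval. Since X stays there surely, it
    is measurable into the restricted space, where \<alpha> is Borel.\<close>
  have "X \<in> M \<rightarrow>\<^sub>M restrict_space borel {0..1}"
    using assms(2) by (intro measurable_restrict_space2) (auto simp: uniform_unit_rv_def)
  then have [measurable]: "(\<lambda>\<omega>. \<alpha> (X \<omega>)) \<in> borel_measurable M"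
    by (rule measurable_compose) (simp add: borel_measurable_mono_on_Icc assms(5))
  have int_m: "integrable M ?m"
  proof (rule integrable_const_bound[of _ 1])
    show "AE \<omega> in M. norm (?m \<omega>) \<le> 1"
      using \<alpha>01 by (intro AE_I2) (auto simp: min_le_iff_disj power_le_one)
  qed measurable
  have "expectation ?m \<le> \<epsilon>\<^sup>2 + 1 / 4 * \<P>(\<omega> in M. \<alpha> (X \<omega>) \<in> {\<epsilon>..1 - \<epsilon>})"
    for \<epsilon>
  proof -
    let ?A = "{\<omega> \<in> space M. \<alpha> (X \<omega>) \<in> {\<epsilon>..1 - \<epsilon>}}"
    have [measurable]: "?A \<in> sets M"
      by measurable
    \<comment> \<open>The indicator of the band at \<alpha>(X) becomes the indicator of the event
      \<open>?A\<close>, whose integral is its probability.\<close>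
    have "expectation ?m \<le> expectation (\<lambda>\<omega>. \<epsilon>\<^sup>2 + 1 / 4 * indicator ?A \<omega>)"
    proof (rule integral_mono[OF int_m])
      show "integrable M (\<lambda>\<omega>. \<epsilon>\<^sup>2 + 1 / 4 * indicator ?A \<omega> :: real)"
        by (auto intro!: Bochner_Integration.integrable_add integrable_mult_right
          simp: emeasure_eq_measure)
      show "?m \<omega> \<le> \<epsilon>\<^sup>2 + 1 / 4 * indicator ?A \<omega>" if "\<omega> \<in> space M" for \<omega>
        using min_sq_le_indicator[OF \<alpha>01[OF that], of \<epsilon>] that
        by (simp add: indicator_def)
    qed
    also have "\<dots> = \<epsilon>\<^sup>2 + 1 / 4 * prob ?A"
      by (subst Bochner_Integration.integral_add) (auto simp: prob_space emeasure_eq_measure)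
    finally show ?thesis .
  qed
  with first show ?thesis
    by (meson mult_left_mono order_trans zero_le_power2)
qed

end
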